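(* Let $\Gamma$ be a (valued) tree with Coxeter transformation ${\bf C}=w_1w_2$, and let $f_p(\beta)$, $g_p(\beta)$ be the polynomials in the matrix $\beta=\frac12K-I$ defined in the context. For every vector $z$ and every positive integer $p$: 1) ${\bf C}^pz=z\iff f_p(\beta)z=0$; 2) ${\bf C}^pz=-z\iff g_p(\beta)z=0$.
   Context: The vertices of $\Gamma$ are split into two classes such that every edge joins the two classes, and the Cartan matrix $K$ and the involutions $w_1,w_2$ are, in block form, $$K=\begin{pmatrix} 2I & 2D \\ 2F & 2I \end{pmatrix},\quad w_1=\begin{pmatrix} -I & -2D \\ 0 & I \end{pmatrix},\quad w_2=\begin{pmatrix} I & 0 \\ -2F & -I \end{pmatrix},\quad \beta=\tfrac12K-I=\begin{pmatrix} 0 & D \\ {F} & 0 \end{pmatrix}.$$ The polynomials (Chebyshev-type) are defined recursively: $f_0(\beta)=0$, $f_1(\beta)=2\beta+2I$, $f_{p+2}(\beta)=2\beta f_{p+1}(\beta)-f_p(\beta)$ for $p\ge0$; and $g_0(\beta)=2I$, $g_1(\beta)=2\beta$, $g_{p+2}(\beta)=2\beta g_{p+1}(\beta)-g_p(\beta)$ for $p\ge0$. *)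

theory Defs
  imports "HOL-Analysis.Analysis"
begin

(* A valued graph on the finite vertex set UNIV :: 'v set: the edge {i, j} carries the pair of
   values (d i j, d j i), and d i j = 0 means that there is no edge. *)
definition valued_graph :: "('v::finite \<Rightarrow> 'v \<Rightarrow> nat) \<Rightarrow> bool" where
  "valued_graph d \<longleftrightarrow>
     (\<forall>i. d i i = 0) \<and>
     (\<forall>i j. d i j \<noteq> 0 \<longleftrightarrow> d j i \<noteq> 0) \<and>
     (\<exists>r :: 'v \<Rightarrow> nat. (\<forall>i. r i > 0) \<and> (\<forall>i j. d i j * r j = d j i * r i))"

definition adj :: "('v \<Rightarrow> 'v \<Rightarrow> nat) \<Rightarrow> 'v \<Rightarrow> 'v \<Rightarrow> bool" where
  "adj d i j \<longleftrightarrow> i \<noteq> j \<and> d i j \<noteq> 0"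

definition circuit :: "('v \<Rightarrow> 'v \<Rightarrow> nat) \<Rightarrow> 'v list \<Rightarrow> bool" where
  "circuit d xs \<longleftrightarrow> length xs \<ge> 3 \<and> distinct xs \<and>
     (\<forall>k < length xs. adj d (xs ! k) (xs ! (Suc k mod length xs)))"

definition valued_tree :: "('v::finite \<Rightarrow> 'v \<Rightarrow> nat) \<Rightarrow> bool" where
  "valued_tree d \<longleftrightarrow> valued_graph d \<and> (\<forall>i j. (adj d)\<^sup>*\<^sup>* i j) \<and> (\<nexists>xs. circuit d xs)"

(* The two classes of vertices are S and - S; one of them is empty for the one-vertex tree. *)
definition bipartition :: "('v \<Rightarrow> 'v \<Rightarrow> nat) \<Rightarrow> 'v set \<Rightarrow> bool" where
  "bipartition d S \<longleftrightarrow> (\<forall>i j. adj d i j \<longrightarrow> (i \<in> S \<longleftrightarrow> j \<notin> S))"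

definition cartan :: "('v::finite \<Rightarrow> 'v \<Rightarrow> nat) \<Rightarrow> 'k::field_char_0 ^ 'v ^ 'v" where
  "cartan d = (\<chi> i j. if i = j then 2 else - of_nat (d i j))"

(* The block matrix (P Q; R T) with respect to the splitting of the index set into S (first) and
   - S (second). P, Q, R, T are full-size matrices, of which only the entries in the respective
   block are used. *)
definition blocks :: "'v set \<Rightarrow> 'k ^ 'v ^ 'v \<Rightarrow> 'k ^ 'v ^ 'v \<Rightarrow> 'k ^ 'v ^ 'v \<Rightarrow> 'k ^ 'v ^ 'v
    \<Rightarrow> 'k ^ 'v ^ 'v" where
  "blocks S P Q R T = (\<chi> i j.
     if i \<in> S then (if j \<in> S then P $ i $ j else Q $ i $ j)
     else (if j \<in> S then R $ i $ j else T $ i $ j))"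

definition D_block :: "('v::finite \<Rightarrow> 'v \<Rightarrow> nat) \<Rightarrow> 'v set \<Rightarrow> 'k::field_char_0 ^ 'v ^ 'v" where
  "D_block d S = (\<chi> i j. if i \<in> S \<and> j \<notin> S then cartan d $ i $ j / 2 else 0)"

definition F_block :: "('v::finite \<Rightarrow> 'v \<Rightarrow> nat) \<Rightarrow> 'v set \<Rightarrow> 'k::field_char_0 ^ 'v ^ 'v" where
  "F_block d S = (\<chi> i j. if i \<notin> S \<and> j \<in> S then cartan d $ i $ j / 2 else 0)"

(* On square matrices of type 'k ^ 'v ^ 'v the operation * is entrywise; the matrix product is **,
   and mat c is the scalar matrix c I. *)
definition w1 :: "('v::finite \<Rightarrow> 'v \<Rightarrow> nat) \<Rightarrow> 'v set \<Rightarrow> 'k::field_char_0 ^ 'v ^ 'v" where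
  "w1 d S = blocks S (- mat 1) (- (mat 2 ** D_block d S)) 0 (mat 1)"

definition w2 :: "('v::finite \<Rightarrow> 'v \<Rightarrow> nat) \<Rightarrow> 'v set \<Rightarrow> 'k::field_char_0 ^ 'v ^ 'v" where
  "w2 d S = blocks S (mat 1) 0 (- (mat 2 ** F_block d S)) (- mat 1)"

definition coxeter :: "('v::finite \<Rightarrow> 'v \<Rightarrow> nat) \<Rightarrow> 'v set \<Rightarrow> 'k::field_char_0 ^ 'v \<Rightarrow> 'k ^ 'v" where
  "coxeter d S z = (w1 d S ** w2 d S) *v z"

definition beta :: "('v::finite \<Rightarrow> 'v \<Rightarrow> nat) \<Rightarrow> 'k::field_char_0 ^ 'v ^ 'v" where
  "beta d = mat (1/2) ** cartan d - mat 1"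

fun f_poly :: "nat \<Rightarrow> 'k::field_char_0 ^ 'v ^ 'v \<Rightarrow> 'k ^ 'v ^ 'v::finite" where
  "f_poly 0 B = 0"
| "f_poly (Suc 0) B = mat 2 ** B + mat 2"
| "f_poly (Suc (Suc p)) B = mat 2 ** B ** f_poly (Suc p) B - f_poly p B"

fun g_poly :: "nat \<Rightarrow> 'k::field_char_0 ^ 'v ^ 'v \<Rightarrow> 'k ^ 'v ^ 'v::finite" where
  "g_poly 0 B = mat 2"
| "g_poly (Suc 0) B = mat 2 ** B"
| "g_poly (Suc (Suc p)) B = mat 2 ** B ** g_poly (Suc p) B - g_poly p B"

lemma mat_mult_nth: "(mat c ** A) $ i $ j = c * (A $ i $ j)"
  for A :: "'k::field_char_0 ^ 'v ^ 'v::finite"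
  by (simp add: matrix_matrix_mult_def mat_def if_distrib[where f = "\<lambda>x. x * _"] sum.delta
      cong: if_cong)

lemma mat_nth: "mat c $ i $ j = (if i = j then c else 0)"
  by (simp add: mat_def)

lemma cartan_blocks:
  assumes "bipartition d S"
  shows "cartan d = blocks S (mat 2) (mat 2 ** D_block d S) (mat 2 ** F_block d S) (mat 2)"
  using assms
  by (auto simp: vec_eq_iff mat_mult_nth cartan_def blocks_def D_block_def F_block_def
      bipartition_def adj_def mat_nth)

lemma beta_blocks:
  assumes "bipartition d S"
  shows "beta d = blocks S 0 (D_block d S) (F_block d S) 0"
  using assms
  by (auto simp: vec_eq_iff mat_mult_nth cartan_def blocks_def D_block_def F_block_def
      bipartition_def adj_def mat_nth beta_def)

end

theory Submission
  imports Defs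
begin

text \<open>The reflections satisfy \<open>w1 + w2 = - 2 \<beta>\<close> and are involutions. Let \<open>P\<^sub>n\<close> and \<open>Q\<^sub>n\<close> be the
  alternating words of length \<open>n\<close> in \<open>w1\<close> and \<open>w2\<close> that end, on the right, in \<open>w2\<close> and in \<open>w1\<close>.
  Multiplying such a word on the left by \<open>w1 + w2\<close> cancels its first letter in one summand and
  prolongs the word in the other; hence both sequences satisfy the recursion
  \<open>X\<^sub>n\<^sub>+\<^sub>2 = - 2 \<beta> X\<^sub>n\<^sub>+\<^sub>1 - X\<^sub>n\<close>, which up to alternating signs is that of the polynomials
  \<open>f\<^sub>n(\<beta>)\<close> and \<open>g\<^sub>n(\<beta>)\<close>. Comparing initial values gives
  \<open>P\<^sub>n + Q\<^sub>n = (- 1)\<^sup>n g\<^sub>n(\<beta>)\<close> and \<open>P\<^sub>n - Q\<^sub>n = E f\<^sub>n(\<beta>)\<close>, where \<open>E\<close> changes the sign of the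
  coordinates outside \<open>S\<close>. In the second identity \<open>E\<close> anticommutes with \<open>\<beta>\<close>, which accounts for the
  signs (\<open>alternating_add\<close>, \<open>alternating_diff\<close>).

  On the other hand \<open>Q\<^sub>n C\<^sup>n = P\<^sub>n\<close>, because the \<open>n\<close> letters of \<open>Q\<^sub>n\<close> cancel the first half of
  \<open>(w1 w2)\<^sup>n\<close> and leave its last \<open>n\<close> letters (\<open>alternating_funpow\<close>). As \<open>Q\<^sub>n\<close> is injective,
  \<open>C\<^sup>n z = \<plusminus> z\<close> means \<open>P\<^sub>n z = \<plusminus> Q\<^sub>n z\<close>, that is, \<open>f\<^sub>n(\<beta>) z = 0\<close> or \<open>g\<^sub>n(\<beta>) z = 0\<close>.\<close>

section \<open>Alternating words in two involutions\<close>

fun alternating :: "nat \<Rightarrow> ('a \<Rightarrow> 'a) \<Rightarrow> ('a \<Rightarrow> 'a) \<Rightarrow> 'a \<Rightarrow> 'a" where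
  "alternating 0 u v z = z"
| "alternating (Suc n) u v z = alternating n v u (u z)"

text \<open>One of \<open>u\<close> and \<open>v\<close> cancels the letter applied last, the other one prolongs the word. The
  symmetric form of the sum makes it irrelevant which of them does which, so that no distinction
  by the parity of \<open>n\<close> is needed.\<close>

lemma alternating_Suc_Suc:
  fixes u v :: "'a::ab_group_add \<Rightarrow> 'a"
  assumes "\<And>x. u (u x) = x" and "\<And>x. v (v x) = x"
  shows "alternating (Suc (Suc n)) u v z =
    u (alternating (Suc n) u v z) + v (alternating (Suc n) u v z) - alternating n u v z"
  using assms
proof (induction n arbitrary: u v z)
  case 0
  then show ?case by simp
next
  case (Suc n)
  show ?case
    using Suc.IH[of v u "u z"] Suc.prems by (simp add: add.commute)
qed

lemma inj_alternating:
  assumes "inj u" and "inj v"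
  shows "inj (alternating n u v)"
  using assms
proof (induction n arbitrary: u v)
  case 0
  show ?case by (rule injI) simp
next
  case (Suc n)
  have "alternating (Suc n) u v = alternating n v u \<circ> u"
    by (simp add: fun_eq_iff)
  then show ?case
    using inj_compose[OF Suc.IH[OF Suc.prems(2,1)] Suc.prems(1)] by (simp only:)
qed

lemma alternating_uminus:
  fixes u v :: "'a::group_add \<Rightarrow> 'a"
  assumes "\<And>x. u (- x) = - u x" and "\<And>x. v (- x) = - v x"
  shows "alternating n u v (- z) = - alternating n u v z"
  using assms by (induction n arbitrary: u v z) simp_all

lemma funpow_comp_rotate: "((v \<circ> u) ^^ n) (v z) = v (((u \<circ> v) ^^ n) z)"
  by (induction n) simp_all

text \<open>Cancelling the first letter of the power turns it into a power of \<open>v \<circ> u\<close> preceded by a single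
  \<open>v\<close>; the induction therefore exchanges the roles of the two involutions.\<close>

lemma alternating_funpow:
  assumes "\<And>x. u (u x) = x" and "\<And>x. v (v x) = x"
  shows "alternating n u v (((u \<circ> v) ^^ n) z) = alternating n v u z"
  using assms
proof (induction n arbitrary: u v z)
  case 0
  then show ?case by simp
next
  case (Suc n)
  have "alternating (Suc n) u v (((u \<circ> v) ^^ Suc n) z) = alternating n v u (v (((u \<circ> v) ^^ n) z))"
    using Suc.prems by simp
  also have "\<dots> = alternating n v u (((v \<circ> u) ^^ n) (v z))"
    by (simp only: funpow_comp_rotate)
  also have "\<dots> = alternating n u v (v z)"
    by (rule Suc.IH) (fact Suc.prems)+
  finally show ?case by (simp only: alternating.simps)
qed

section \<open>The reflections in coordinates\<close>

definition flip :: "'v set \<Rightarrow> 'k::ab_group_add ^ 'v \<Rightarrow> 'k ^ 'v" where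
  "flip S z = (\<chi> i. if i \<in> S then z $ i else - z $ i)"

lemma mat_mult_vec: "mat c *v z = c *s z"
  for z :: "'k::field_char_0 ^ 'v::finite"
  by (simp add: vec_eq_iff matrix_vector_mult_def mat_nth if_distrib[where f = "\<lambda>x. x * _"]
      sum.delta cong: if_cong)

context
  fixes d :: "'v::finite \<Rightarrow> 'v \<Rightarrow> nat" and S :: "'v set"
  assumes bip: "bipartition d S"
begin

lemma beta_eq_0:
  assumes "i \<in> S \<longleftrightarrow> j \<in> S"
  shows "(beta d :: 'k::field_char_0 ^ 'v ^ 'v) $ i $ j = 0"
  using assms by (simp add: beta_blocks[OF bip] blocks_def)

lemma beta_mult_cong:
  fixes x y :: "'k::field_char_0 ^ 'v"
  assumes "\<And>j. (j \<in> S) \<noteq> (i \<in> S) \<Longrightarrow> x $ j = y $ j"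
  shows "(beta d *v x) $ i = (beta d *v y) $ i"
proof -
  have "beta d $ i $ j * x $ j = beta d $ i $ j * y $ j" for j
    using assms[of j] by (cases "i \<in> S \<longleftrightarrow> j \<in> S") (auto simp: beta_eq_0)
  then show ?thesis by (simp only: matrix_vector_mult_def vec_lambda_beta)
qed

lemma w1_mult_nth:
  fixes z :: "'k::field_char_0 ^ 'v"
  shows "(w1 d S *v z) $ i = (if i \<in> S then - z $ i - 2 * (beta d *v z) $ i else z $ i)"
proof -
  have "w1 d S $ i = (if i \<in> S then - (mat 1 $ i) - 2 *s (beta d $ i) else mat 1 $ i :: 'k ^ 'v)"
    by (auto simp: vec_eq_iff w1_def beta_blocks[OF bip] blocks_def mat_nth mat_mult_nth)
  then have "(w1 d S *v z) $ i =
      (if i \<in> S then - (mat 1 *v z) $ i - 2 * (beta d *v z) $ i else (mat 1 *v z) $ i)"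
    by (simp add: matrix_vector_mult_def left_diff_distrib sum_subtractf sum_negf
        sum_distrib_left mult.assoc)
  then show ?thesis by simp
qed

lemma w2_mult_nth:
  fixes z :: "'k::field_char_0 ^ 'v"
  shows "(w2 d S *v z) $ i = (if i \<in> S then z $ i else - z $ i - 2 * (beta d *v z) $ i)"
proof -
  have "w2 d S $ i = (if i \<in> S then mat 1 $ i else - (mat 1 $ i) - 2 *s (beta d $ i) :: 'k ^ 'v)"
    by (auto simp: vec_eq_iff w2_def beta_blocks[OF bip] blocks_def mat_nth mat_mult_nth)
  then have "(w2 d S *v z) $ i =
      (if i \<in> S then (mat 1 *v z) $ i else - (mat 1 *v z) $ i - 2 * (beta d *v z) $ i)"
    by (simp add: matrix_vector_mult_def left_diff_distrib sum_subtractf sum_negf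
        sum_distrib_left mult.assoc)
  then show ?thesis by simp
qed

text \<open>The vectors \<open>w1 z\<close> and \<open>z\<close> differ only inside \<open>S\<close>, and the coordinates of \<open>\<beta> z\<close> inside \<open>S\<close>
  depend only on those of \<open>z\<close> outside \<open>S\<close>.\<close>

lemma w1_involution: "w1 d S *v (w1 d S *v z) = z"
  for z :: "'k::field_char_0 ^ 'v"
proof -
  have "(beta d *v (w1 d S *v z)) $ i = (beta d *v z) $ i" if "i \<in> S" for i
    using that by (intro beta_mult_cong) (simp add: w1_mult_nth)
  then show ?thesis by (simp add: vec_eq_iff w1_mult_nth)
qed

lemma w2_involution: "w2 d S *v (w2 d S *v z) = z"
  for z :: "'k::field_char_0 ^ 'v"
proof -
  have "(beta d *v (w2 d S *v z)) $ i = (beta d *v z) $ i" if "i \<notin> S" for i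
    using that by (intro beta_mult_cong) (simp add: w2_mult_nth)
  then show ?thesis by (simp add: vec_eq_iff w2_mult_nth)
qed

lemma w1_add_w2: "w1 d S *v z + w2 d S *v z = - (2 *s (beta d *v z))"
  for z :: "'k::field_char_0 ^ 'v"
  by (simp add: vec_eq_iff w1_mult_nth w2_mult_nth)

lemma w2_diff_w1: "w2 d S *v z - w1 d S *v z = flip S (2 *s (beta d *v z) + 2 *s z)"
  for z :: "'k::field_char_0 ^ 'v"
  by (simp add: vec_eq_iff w1_mult_nth w2_mult_nth flip_def)

text \<open>This anticommutation holds because \<open>\<beta>\<close> exchanges the two coordinate subspaces on which \<open>flip\<close>
  acts as \<open>1\<close> and as \<open>- 1\<close>.\<close>

lemma beta_mult_flip: "beta d *v flip S z = - flip S (beta d *v z)"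
  for z :: "'k::field_char_0 ^ 'v"
proof -
  have "(beta d *v flip S z) $ i = (if i \<in> S then - (beta d *v z) $ i else (beta d *v z) $ i)" for i
  proof (cases "i \<in> S")
    case True
    then have "(beta d *v flip S z) $ i = (beta d *v (- z)) $ i"
      by (intro beta_mult_cong) (simp add: flip_def)
    with True show ?thesis
      by (simp add: matrix_vector_mult_def sum_negf)
  next
    case False
    then have "(beta d *v flip S z) $ i = (beta d *v z) $ i"
      by (intro beta_mult_cong) (simp add: flip_def)
    with False show ?thesis by simp
  qed
  then show ?thesis by (simp add: vec_eq_iff flip_def)
qed

section \<open>Chebyshev polynomials as sums and differences of words\<close>

lemma alternating_w2_w1_rec:
  fixes z :: "'k::field_char_0 ^ 'v"
  shows "alternating (Suc (Suc n)) ((*v) (w2 d S)) ((*v) (w1 d S)) z =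
    - (2 *s (beta d *v alternating (Suc n) ((*v) (w2 d S)) ((*v) (w1 d S)) z))
    - alternating n ((*v) (w2 d S)) ((*v) (w1 d S)) z"
  by (subst alternating_Suc_Suc)
    (simp_all only: w1_involution w2_involution w1_add_w2[symmetric] add.commute)

lemma alternating_w1_w2_rec:
  fixes z :: "'k::field_char_0 ^ 'v"
  shows "alternating (Suc (Suc n)) ((*v) (w1 d S)) ((*v) (w2 d S)) z =
    - (2 *s (beta d *v alternating (Suc n) ((*v) (w1 d S)) ((*v) (w2 d S)) z))
    - alternating n ((*v) (w1 d S)) ((*v) (w2 d S)) z"
  by (subst alternating_Suc_Suc)
    (simp_all only: w1_involution w2_involution w1_add_w2[symmetric])

lemma alternating_diff:
  fixes z :: "'k::field_char_0 ^ 'v"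
  shows "alternating n ((*v) (w2 d S)) ((*v) (w1 d S)) z
    - alternating n ((*v) (w1 d S)) ((*v) (w2 d S)) z = flip S (f_poly n (beta d) *v z)"
    (is "?P n - ?Q n = flip S (?f n)")
proof (induction n rule: induct_nat_012)
  case 0
  show ?case by (simp add: flip_def vec_eq_iff)
next
  case 1
  show ?case
    using w2_diff_w1[of z]
    by (simp add: matrix_vector_mult_add_rdistrib mat_mult_vec flip: matrix_vector_mul_assoc)
next
  case (ge2 n)
  have "?P (Suc (Suc n)) - ?Q (Suc (Suc n)) =
      - (2 *s (beta d *v (?P (Suc n) - ?Q (Suc n)))) - (?P n - ?Q n)"
    unfolding alternating_w1_w2_rec alternating_w2_w1_rec
    by (simp add: matrix_vector_mult_diff_distrib vec_eq_iff algebra_simps)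
  also have "\<dots> = - (2 *s (beta d *v flip S (?f (Suc n)))) - flip S (?f n)"
    by (simp only: ge2)
  also have "\<dots> = flip S (2 *s (beta d *v ?f (Suc n)) - ?f n)"
    by (simp add: beta_mult_flip) (simp add: vec_eq_iff flip_def)
  also have "\<dots> = flip S (?f (Suc (Suc n)))"
    by (simp add: matrix_vector_mult_diff_rdistrib mat_mult_vec flip: matrix_vector_mul_assoc)
  finally show ?case .
qed

lemma alternating_add:
  fixes z :: "'k::field_char_0 ^ 'v"
  shows "alternating n ((*v) (w2 d S)) ((*v) (w1 d S)) z
    + alternating n ((*v) (w1 d S)) ((*v) (w2 d S)) z = (- 1) ^ n *s (g_poly n (beta d) *v z)"
    (is "?P n + ?Q n = _ *s ?g n")
proof (induction n rule: induct_nat_012)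
  case 0
  show ?case by (simp add: vec_eq_iff mat_mult_vec)
next
  case 1
  show ?case
    using w1_add_w2[of z]
    by (simp add: mat_mult_vec add.commute vec_eq_iff flip: matrix_vector_mul_assoc)
next
  case (ge2 n)
  have "?P (Suc (Suc n)) + ?Q (Suc (Suc n)) =
      - (2 *s (beta d *v (?P (Suc n) + ?Q (Suc n)))) - (?P n + ?Q n)"
    unfolding alternating_w1_w2_rec alternating_w2_w1_rec
    by (simp add: matrix_vector_right_distrib vec_eq_iff algebra_simps)
  also have "\<dots> = - (2 *s (beta d *v ((- 1) ^ Suc n *s ?g (Suc n)))) - (- 1) ^ n *s ?g n"
    by (simp only: ge2)
  also have "\<dots> = (- 1) ^ n *s (2 *s (beta d *v ?g (Suc n)) - ?g n)"
    by (simp only: vector_scalar_commute) (simp add: vec_eq_iff algebra_simps)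
  also have "\<dots> = (- 1) ^ Suc (Suc n) *s ?g (Suc (Suc n))"
    by (simp add: matrix_vector_mult_diff_rdistrib mat_mult_vec flip: matrix_vector_mul_assoc)
  finally show ?case .
qed

end

theorem theoremB19:
  fixes d :: "'v::finite \<Rightarrow> 'v \<Rightarrow> nat"
    and S :: "'v set"
    and z :: "'k::field_char_0 ^ 'v"
    and p :: nat
  assumes "valued_tree d"
    and "bipartition d S"
    and "p > 0"
  shows "((coxeter d S ^^ p) z = z \<longleftrightarrow> f_poly p (beta d) *v z = 0) \<and>
         ((coxeter d S ^^ p) z = - z \<longleftrightarrow> g_poly p (beta d) *v z = 0)"
proof -
  define u v :: "'k ^ 'v \<Rightarrow> 'k ^ 'v" where "u = (*v) (w1 d S)" and "v = (*v) (w2 d S)"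
  note bip = \<open>bipartition d S\<close>
  have uu: "u (u x) = x" and vv: "v (v x) = x" for x
    by (simp_all add: u_def v_def w1_involution[OF bip] w2_involution[OF bip])
  have "coxeter d S = u \<circ> v"
    by (simp add: fun_eq_iff coxeter_def u_def v_def matrix_vector_mul_assoc)
  then have word: "alternating p u v ((coxeter d S ^^ p) z) = alternating p v u z"
    by (simp add: alternating_funpow uu vv)
  have "inj u" "inj v"
    by (metis injI uu) (metis injI vv)
  then have inj: "inj (alternating p u v)"
    by (rule inj_alternating)
  have neg: "alternating p u v (- z) = - alternating p u v z"
    by (rule alternating_uminus)
      (simp_all add: u_def v_def matrix_vector_mult_def vec_eq_iff sum_negf)
  have "(coxeter d S ^^ p) z = z \<longleftrightarrow> alternating p v u z - alternating p u v z = 0"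
    using inj_eq[OF inj, of "(coxeter d S ^^ p) z" z] by (simp add: word)
  also have "\<dots> \<longleftrightarrow> flip S (f_poly p (beta d) *v z) = 0"
    by (simp only: u_def v_def alternating_diff[OF bip])
  also have "\<dots> \<longleftrightarrow> f_poly p (beta d) *v z = 0"
    by (auto simp: flip_def vec_eq_iff split: if_splits)
  finally have f: "(coxeter d S ^^ p) z = z \<longleftrightarrow> f_poly p (beta d) *v z = 0" .
  have "(coxeter d S ^^ p) z = - z \<longleftrightarrow> alternating p v u z + alternating p u v z = 0"
    using inj_eq[OF inj, of "(coxeter d S ^^ p) z" "- z"]
    by (simp add: word neg eq_neg_iff_add_eq_0)
  also have "\<dots> \<longleftrightarrow> (- 1) ^ p *s (g_poly p (beta d) *v z) = 0"
    by (simp only: u_def v_def alternating_add[OF bip])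
  also have "\<dots> \<longleftrightarrow> g_poly p (beta d) *v z = 0"
    by (simp add: vec_eq_iff)
  finally show ?thesis
    using f by blast
qed

end
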